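(* Let $\lambda=(\lambda_1,\dots,\lambda_n)$ be a partition of height $n$ (so $\lambda_n>0$). Let $k\ge 1$ and suppose there are $k$ row numbers $2\le r_1<r_2<\dots<r_k<r_{k+1}:=n+1$ such that $\lambda_{r_i}<\lambda_{r_i-1}$ for $1\le i\le k$. Let the integers $t_i,m_i$ ($1\le i\le k$) satisfy $$1\le t_i\le \lambda_{r_i-1}-\lambda_{r_i},\qquad 1\le m_i\le r_{i+1}-r_i,\qquad 1\le i\le k.$$ Let $\lambda^+$ denote the sequence obtained from $\lambda$ by adding $k$ border strips, the $i$-th of which occupies the $m_i$ rows $r_i,\dots,r_i+m_i-1$ and has $t_i$ boxes in its end row $r_i$. Then $\lambda^+$ is well defined as a partition (Young diagram), and the following identity holds for Schur symmetric functions: $$s_{\lambda}\, s_{\lambda^+\downarrow}\;=\;s_{\lambda^+}\, s_{\lambda\downarrow}\;+\;\sum_{p=1}^k s_{\lambda^+\downarrow^{(r_p)}}\; s_{\lambda\uparrow_{(r_p-1,\,t_p)}}.$$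
   Context: Schur symmetric functions $s_\lambda$ are elements of the ring $\Lambda$ of symmetric functions over $\mathbb{Z}$ in countably many indeterminates; $s_\lambda=\det\|h_{\lambda_i-i+j}\|_{1\le i,j\le N}$ for any $N\ge\ell(\lambda)$, where $h_k$ are the complete symmetric functions ($h_0=1$, $h_k=0$ for $k<0$). Partitions are identified with Young diagrams; the height $\ell(\lambda)$ is the number of nonzero components; trailing zeros are ignored. Adding border strips: the partition $\lambda^+$ (written ${\lambda^+}^{t_1\dots t_k}_{(r_1,m_1)\dots(r_k,m_k)}$ in full) has $n$ components given by $\lambda^+_{r_i}=\lambda_{r_i}+t_i$ for $1\le i\le k$; $\lambda^+_{r_i+j}=\lambda_{r_i+j-1}+1$ for $1\le i\le k$, $1\le j\le m_i-1$; and $\lambda^+_r=\lambda_r$ for all other rows $r$. Peeling the complete border strip: for a partition $\nu=(\nu_1,\dots,\nu_n)$ of height $n$, $\nu\downarrow=(\nu_2-1,\nu_3-1,\dots,\nu_n-1,0)$, i.e. the diagram obtained by removing the first row and the first column. Partial down-peeling: for $1\le r\le n$, $\nu\downarrow^{(r)}=(\nu_1,\dots,\nu_{r-1},\nu_{r+1}-1,\dots,\nu_n-1,0)$. Partial up-peeling: for $1\le r\le n-1$ and $1\le s\le \nu_r-\nu_{r+1}$, $\nu\uparrow_{(r,s)}=(\nu_2-1,\dots,\nu_r-1,\ \nu_{r+1}+s-1,\ \nu_{r+1},\nu_{r+2},\dots,\nu_n)$, where the component $\nu_{r+1}+s-1$ stands in position $r$ and the components in positions $r+1,\dots,n$ are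 those of $\nu$. *)

theory Defs
  imports "HOL-Library.Multiset" "Jordan_Normal_Form.Determinant"
begin

section \<open>The ring of symmetric functions over the integers\<close>

text \<open>
  A formal power series with integer coefficients in the indeterminates
  \<open>x\<^sub>0, x\<^sub>1, x\<^sub>2, \<dots>\<close> is given by its coefficient function; the monomial
  \<open>x\<^sub>i \<dots> x\<^sub>j\<close> is represented by the multiset of its indices, so the degree
  of a monomial is the size of the multiset and the product of monomials is the sum of multisets.
  A symmetric function is such a series of bounded degree which is invariant under
  permutations of the indeterminates.
\<close>

definition symmetric_coeffs :: "(nat multiset \<Rightarrow> int) \<Rightarrow> bool" where
  "symmetric_coeffs f \<longleftrightarrow> (\<forall>\<pi> M. bij \<pi> \<longrightarrow> f (image_mset \<pi> M) = f M)"

definition bounded_degree :: "(nat multiset \<Rightarrow> int) \<Rightarrow> bool" where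
  "bounded_degree f \<longleftrightarrow> (\<exists>d. \<forall>M. f M \<noteq> 0 \<longrightarrow> size M \<le> d)"

typedef symfun = "{f. symmetric_coeffs f \<and> bounded_degree f}"
  morphisms sf_coeff Abs_symfun
  by (rule exI[of _ "\<lambda>_. 0"]) (simp add: symmetric_coeffs_def bounded_degree_def)

setup_lifting type_definition_symfun

definition splittings :: "nat multiset \<Rightarrow> (nat multiset \<times> nat multiset) set" where
  "splittings M = {(A, B). A + B = M}"

lemma finite_splittings [simp]: "finite (splittings M)"
proof -
  have "finite {A. A \<subseteq># M}"
  proof -
    have "{A. A \<subseteq># M} \<subseteq> mset ` {xs. set xs \<subseteq> set_mset M \<and> length xs \<le> size M}"
    proof
      fix A assume "A \<in> {A. A \<subseteq># M}"
      then have A: "A \<subseteq># M" by simp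
      obtain xs where xs: "mset xs = A" using ex_mset by blast
      have "set xs \<subseteq> set_mset M" using set_mset_mono[OF A] xs by auto
      moreover have "length xs \<le> size M" using size_mset_mono[OF A] xs by auto
      ultimately show "A \<in> mset ` {xs. set xs \<subseteq> set_mset M \<and> length xs \<le> size M}"
        using xs by blast
    qed
    then show ?thesis
      by (rule finite_subset) (intro finite_imageI finite_lists_length_le finite_set_mset)
  qed
  moreover have "splittings M \<subseteq> (\<lambda>A. (A, M - A)) ` {A. A \<subseteq># M}"
    by (auto simp: splittings_def image_iff)
  ultimately show ?thesis by (blast intro: finite_subset)
qed

definition convolution ::
  "(nat multiset \<Rightarrow> int) \<Rightarrow> (nat multiset \<Rightarrow> int) \<Rightarrow> nat multiset \<Rightarrow> int" where
  "convolution f g M = (\<Sum>(A, B)\<in>splittings M. f A * g B)"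

lemma symmetric_coeffs_convolution:
  assumes f: "symmetric_coeffs f" and g: "symmetric_coeffs g"
  shows "symmetric_coeffs (convolution f g)"
  unfolding symmetric_coeffs_def
proof (intro allI impI)
  fix \<pi> :: "nat \<Rightarrow> nat" and M assume \<pi>: "bij \<pi>"
  have 1: "image_mset (inv_into UNIV \<pi>) (image_mset \<pi> A) = A" for A
    using \<pi> by (simp add: multiset.map_comp o_def bij_is_inj)
  have 2: "image_mset \<pi> (image_mset (inv_into UNIV \<pi>) A) = A" for A
    using \<pi> by (simp add: multiset.map_comp o_def bij_is_surj surj_f_inv_f)
  have "convolution f g M = convolution f g (image_mset \<pi> M)"
    unfolding convolution_def
    by (rule sum.reindex_bij_witness[of _
          "\<lambda>(A, B). (image_mset (inv_into UNIV \<pi>) A, image_mset (inv_into UNIV \<pi>) B)"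
          "\<lambda>(A, B). (image_mset \<pi> A, image_mset \<pi> B)"])
       (use f g \<pi> in \<open>auto simp: splittings_def 1 2 symmetric_coeffs_def simp flip: image_mset_union\<close>)
  then show "convolution f g (image_mset \<pi> M) = convolution f g M" by simp
qed

lemma bounded_degree_convolution:
  assumes f: "bounded_degree f" and g: "bounded_degree g"
  shows "bounded_degree (convolution f g)"
proof -
  obtain d e where d: "\<And>M. f M \<noteq> 0 \<Longrightarrow> size M \<le> d" and e: "\<And>M. g M \<noteq> 0 \<Longrightarrow> size M \<le> e"
    using f g unfolding bounded_degree_def by blast
  have "size M \<le> d + e" if "convolution f g M \<noteq> 0" for M
  proof -
    from that obtain A B where "A + B = M" "f A * g B \<noteq> 0"
      unfolding convolution_def splittings_def by (auto elim!: sum.not_neutral_contains_not_neutral)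
    then show ?thesis using d[of A] e[of B] by auto
  qed
  then show ?thesis unfolding bounded_degree_def by blast
qed

lemma convolution_commute: "convolution f g = convolution g f"
  unfolding convolution_def fun_eq_iff
  by (intro allI sum.reindex_bij_witness[of _ prod.swap prod.swap])
     (auto simp: splittings_def add.commute mult.commute)

lemma convolution_assoc: "convolution (convolution f g) k = convolution f (convolution g k)"
proof
  fix M
  have "convolution (convolution f g) k M =
      (\<Sum>(p, q)\<in>Sigma (splittings M) (\<lambda>p. splittings (fst p)). f (fst q) * g (snd q) * k (snd p))"
    unfolding convolution_def
    by (subst sum.Sigma [symmetric]) (auto simp: sum_distrib_right case_prod_unfold)
  also have "\<dots> =
      (\<Sum>(p, q)\<in>Sigma (splittings M) (\<lambda>p. splittings (snd p)). f (fst p) * (g (fst q) * k (snd q)))"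
    by (rule sum.reindex_bij_witness[of _
          "\<lambda>(p, q). ((fst p + fst q, snd q), (fst p, fst q))"
          "\<lambda>(p, q). ((fst q, snd q + snd p), (snd q, snd p))"])
       (auto simp: splittings_def add.assoc mult.assoc)
  also have "\<dots> = convolution f (convolution g k) M"
    unfolding convolution_def
    by (subst sum.Sigma [symmetric]) (auto simp: sum_distrib_left case_prod_unfold)
  finally show "convolution (convolution f g) k M = convolution f (convolution g k) M" .
qed

lemma convolution_one: "convolution (\<lambda>M. if M = {#} then 1 else 0) f = f"
proof
  fix M
  have "convolution (\<lambda>M. if M = {#} then 1 else 0) f M =
      (\<Sum>(A, B)\<in>{({#} :: nat multiset, M)}. (if A = {#} then 1 else 0) * f B)"
    unfolding convolution_def
    by (rule sum.mono_neutral_right[OF finite_splittings]) (auto simp: splittings_def split: if_splits)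
  then show "convolution (\<lambda>M. if M = {#} then 1 else 0) f M = f M" by simp
qed

lemma convolution_add_left:
  "convolution (\<lambda>M. f M + g M) k M = convolution f k M + convolution g k M"
  unfolding convolution_def by (simp add: case_prod_unfold sum.distrib distrib_right)

lemma bounded_degree_add:
  assumes f: "bounded_degree f" and g: "bounded_degree g"
  shows "bounded_degree (\<lambda>M. f M + g M)"
proof -
  obtain d e where d: "\<And>M. f M \<noteq> 0 \<Longrightarrow> size M \<le> d" and e: "\<And>M. g M \<noteq> 0 \<Longrightarrow> size M \<le> e"
    using f g unfolding bounded_degree_def by blast
  have "size M \<le> max d e" if "f M + g M \<noteq> 0" for M
    using that d[of M] e[of M] by (cases "f M = 0") (auto simp: le_max_iff_disj)
  then show ?thesis unfolding bounded_degree_def by blast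
qed

instantiation symfun :: comm_ring_1
begin

lift_definition zero_symfun :: symfun is "\<lambda>_. 0"
  by (simp add: symmetric_coeffs_def bounded_degree_def)

lift_definition one_symfun :: symfun is "\<lambda>M. if M = {#} then 1 else 0"
  by (auto simp: symmetric_coeffs_def bounded_degree_def)

lift_definition plus_symfun :: "symfun \<Rightarrow> symfun \<Rightarrow> symfun" is "\<lambda>f g M. f M + g M"
  by (simp add: bounded_degree_add symmetric_coeffs_def)

lift_definition uminus_symfun :: "symfun \<Rightarrow> symfun" is "\<lambda>f M. - f M"
  by (simp add: symmetric_coeffs_def bounded_degree_def)

definition minus_symfun :: "symfun \<Rightarrow> symfun \<Rightarrow> symfun" where
  "minus_symfun f g = f + - g"

lift_definition times_symfun :: "symfun \<Rightarrow> symfun \<Rightarrow> symfun" is convolution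
  by (simp add: symmetric_coeffs_convolution bounded_degree_convolution)

instance
proof
  fix a b c :: symfun
  show "a * b * c = a * (b * c)" by transfer (rule convolution_assoc)
  show "a * b = b * a" by transfer (rule convolution_commute)
  show "1 * a = a" by transfer (rule convolution_one)
  show "a + b + c = a + (b + c)" by transfer (simp add: add.assoc)
  show "a + b = b + a" by transfer (simp add: add.commute)
  show "0 + a = a" by transfer simp
  show "- a + a = 0" by transfer simp
  show "a - b = a + - b" by (rule minus_symfun_def)
  show "(a + b) * c = a * c + b * c" by transfer (simp add: fun_eq_iff convolution_add_left)
  show "(0::symfun) \<noteq> 1" by transfer (simp add: fun_eq_iff)
qed

end

lemma bounded_degree_complete: "bounded_degree (\<lambda>M. if int (size M) = k then 1 else 0)"
  unfolding bounded_degree_def by (rule exI[of _ "nat k"]) auto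

text \<open>The complete symmetric function \<open>h\<^sub>k\<close> is the sum of all monomials of degree \<open>k\<close>;
  it vanishes for negative \<open>k\<close>, as no monomial has negative degree.\<close>

lift_definition complete_sym :: "int \<Rightarrow> symfun" is
  "\<lambda>k M. if int (size M) = k then 1 else 0"
  by (simp add: symmetric_coeffs_def bounded_degree_complete)

lemma complete_sym_0 [simp]: "complete_sym 0 = 1"
  by transfer (auto simp: fun_eq_iff)

lemma complete_sym_neg [simp]: "k < 0 \<Longrightarrow> complete_sym k = 0"
  by transfer (auto simp: fun_eq_iff)


section \<open>Partitions and Schur functions\<close>

text \<open>
  A partition is a weakly decreasing finite list of nonnegative integers, possibly with trailing
  zeros.  The entries have type \<open>int\<close>, so that subtraction on them is not truncated.
  Rows are numbered from 1; \<open>part \<nu> i\<close> is the length of row \<open>i\<close>.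
\<close>

definition is_partition :: "int list \<Rightarrow> bool" where
  "is_partition \<nu> \<longleftrightarrow> sorted_wrt (\<ge>) \<nu> \<and> (\<forall>x\<in>set \<nu>. 0 \<le> x)"

definition height :: "int list \<Rightarrow> nat" where
  "height \<nu> = length (filter (\<lambda>x. x \<noteq> 0) \<nu>)"

definition part :: "int list \<Rightarrow> nat \<Rightarrow> int" where
  "part \<nu> i = \<nu> ! (i - 1)"

text \<open>
  The size \<open>N\<close> of the Jacobi--Trudi determinant is the length of the given list, which is at
  least the height.  By \<open>schur_append_zero\<close> below, trailing zeros do not matter.
  Matrix indices start at 0, but \<open>\<lambda>\<^sub>i - i + j\<close> depends only on \<open>\<lambda>\<^sub>i\<close> and \<open>j - i\<close>.
\<close>

definition schur :: "int list \<Rightarrow> symfun" where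
  "schur \<nu> = det (mat (length \<nu>) (length \<nu>)
     (\<lambda>(i, j). complete_sym (\<nu> ! i - int i + int j)))"

lemma schur_append_zero: "schur (\<nu> @ [0]) = schur \<nu>"
proof -
  define n where "n = length \<nu>"
  define A where "A = mat (Suc n) (Suc n)
     (\<lambda>(i, j). complete_sym ((\<nu> @ [0]) ! i - int i + int j))"
  have A: "A \<in> carrier_mat (Suc n) (Suc n)" by (simp add: A_def)
  have "schur (\<nu> @ [0]) = det A" by (simp add: schur_def A_def n_def)
  also have "\<dots> = (\<Sum>j<Suc n. A $$ (n, j) * cofactor A n j)"
    by (rule laplace_expansion_row[OF A]) simp
  also have "\<dots> = (\<Sum>j\<in>{n}. A $$ (n, j) * cofactor A n j)"
    by (rule sum.mono_neutral_right) (auto simp: A_def n_def nth_append)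
  also have "\<dots> = det (mat_delete A n n)"
    by (simp add: cofactor_def A_def n_def nth_append flip: mult_2)
  also have "mat_delete A n n = mat n n (\<lambda>(i, j). complete_sym (\<nu> ! i - int i + int j))"
    by (rule eq_matI) (auto simp: mat_delete_def A_def n_def nth_append)
  finally show ?thesis by (simp add: schur_def n_def)
qed


section \<open>Adding and peeling border strips\<close>

text \<open>
  \<open>border_strips_added \<lambda> k r t m \<mu>\<close> means that \<open>\<mu>\<close> is obtained from \<open>\<lambda>\<close> by adding \<open>k\<close> border
  strips; the \<open>i\<close>-th one (\<open>1 \<le> i \<le> k\<close>) occupies the rows \<open>r i, \<dots>, r i + m i - 1\<close> and has
  \<open>t i\<close> boxes in row \<open>r i\<close>.  It is a relation because the clauses for different strips
  could a priori conflict: existence and uniqueness of \<open>\<mu>\<close> have to be proved.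
\<close>

definition border_strips_added ::
  "int list \<Rightarrow> nat \<Rightarrow> (nat \<Rightarrow> nat) \<Rightarrow> (nat \<Rightarrow> int) \<Rightarrow> (nat \<Rightarrow> nat) \<Rightarrow> int list \<Rightarrow> bool" where
  "border_strips_added \<nu> k r t m \<mu> \<longleftrightarrow>
     length \<mu> = length \<nu> \<and>
     (\<forall>i\<in>{1..k}. part \<mu> (r i) = part \<nu> (r i) + t i) \<and>
     (\<forall>i\<in>{1..k}. \<forall>j\<in>{1..m i - 1}. part \<mu> (r i + j) = part \<nu> (r i + j - 1) + 1) \<and>
     (\<forall>q\<in>{1..length \<nu>}. (\<forall>i\<in>{1..k}. q \<notin> {r i..<r i + m i}) \<longrightarrow> part \<mu> q = part \<nu> q)"

text \<open>\<open>\<nu>\<down>\<close>\<close>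

definition peel :: "int list \<Rightarrow> int list" where
  "peel \<nu> = map (\<lambda>x. x - 1) (tl \<nu>) @ [0]"

text \<open>\<open>\<nu>\<down>\<close> with superscript \<open>(r)\<close>\<close>

definition peel_down :: "nat \<Rightarrow> int list \<Rightarrow> int list" where
  "peel_down r \<nu> = take (r - 1) \<nu> @ map (\<lambda>x. x - 1) (drop r \<nu>) @ [0]"

text \<open>\<open>\<nu>\<up>\<close> with subscript \<open>(r, s)\<close>\<close>

definition peel_up :: "nat \<Rightarrow> int \<Rightarrow> int list \<Rightarrow> int list" where
  "peel_up r s \<nu> = map (\<lambda>x. x - 1) (take (r - 1) (tl \<nu>)) @ [part \<nu> (r + 1) + s - 1] @ drop r \<nu>"

end

theory Submission
  imports Defs
begin

text \<open>
  Write \<open>\<beta>\<^sub>i = \<lambda>\<^sub>i - i\<close> and let \<open>[\<beta>\<^sub>1, \<dots>, \<beta>\<^sub>n]\<close> be the determinant whose row with label \<open>\<beta>\<close> is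
  \<open>(h\<^bsub>\<beta>+1\<^esub>, \<dots>, h\<^bsub>\<beta>+n\<^esub>)\<close>, so that \<open>s\<^sub>\<lambda> = [\<beta>\<^sub>1, \<dots>, \<beta>\<^sub>n]\<close>.  Deleting a row of the diagram and
  shortening all later rows by one box deletes a label without changing the others, and the zero
  part that is appended has the label \<open>-n\<close>.  Adding a border strip in rows
  \<open>r, \<dots>, r + m - 1\<close> inserts the label \<open>c = \<beta>\<^sub>r + t\<close> in position \<open>r\<close>, moves
  \<open>\<beta>\<^sub>r, \<dots>, \<beta>\<^bsub>r+m-2\<^esub>\<close> one position down and drops \<open>\<beta>\<^bsub>r+m-1\<^esub>\<close>.  Thus the labels of \<open>\<lambda>\<^sup>+\<close> are labels
  of \<open>\<lambda>\<close> except for one new label \<open>c\<^sub>p\<close>, in position \<open>r\<^sub>p\<close>, for each strip, and the first label is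
  still \<open>\<beta>\<^sub>1\<close>.  Up-peeling \<open>\<lambda>\<close> at \<open>(r\<^sub>p - 1, t\<^sub>p)\<close> deletes \<open>\<beta>\<^sub>1\<close> and inserts \<open>c\<^sub>p\<close> just before the
  label of row \<open>r\<^sub>p\<close>.

  In these terms, the left-hand side of the identity is
  \<open>[\<beta>\<^sub>1, \<beta>\<^sub>2, \<dots>, \<beta>\<^sub>n] \<cdot> [\<beta>\<^sup>+\<^sub>2, \<dots>, \<beta>\<^sup>+\<^sub>n, -n]\<close>.  The Pluecker relation
  (\<open>row_det_pluecker\<close>) writes it as the sum over all ways of exchanging \<open>\<beta>\<^sub>1\<close> with a row of the
  second factor.  If the row that enters the first factor is one of \<open>\<beta>\<^sub>2, \<dots>, \<beta>\<^sub>n\<close>, that factor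
  has two equal rows and vanishes.  The exchange with \<open>-n\<close> gives \<open>s(\<lambda>\<^sup>+) s(\<lambda>\<down>)\<close>, and the exchange
  with \<open>c\<^sub>p\<close> gives the \<open>p\<close>-th term of the sum.  In each case both factors need the same number of
  transpositions to be put in order, so that the signs cancel (\<open>row_det_exchange\<close>).

  That \<open>\<lambda>\<^sup>+\<close> exists, is unique and is a partition is a matter of checking rows, once it is known
  that the strips occupy disjoint sets of rows (\<open>strips_disjoint\<close>).
\<close>

section \<open>Determinants indexed by lists of rows\<close>

text \<open>
  Labelling the rows turns row operations into operations on the list of labels, and lets
  determinants with different sets of rows be compared.
\<close>

definition row_det :: "('b \<Rightarrow> nat \<Rightarrow> 'a :: comm_ring_1) \<Rightarrow> 'b list \<Rightarrow> 'a" where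
  "row_det f xs = det (mat (length xs) (length xs) (\<lambda>(i, j). f (xs ! i) j))"

lemma row_det_repeated:
  assumes "x \<in> set xs"
  shows "row_det f (x # xs) = 0"
proof -
  obtain i where "i < length xs" "xs ! i = x" using assms by (auto simp: in_set_conv_nth)
  then show ?thesis
    unfolding row_det_def
    by (intro det_identical_rows[of _ "Suc (length xs)" 0 "Suc i"]) (auto intro!: eq_vecI)
qed

lemma row_det_swap_adjacent:
  "row_det f (us @ x # y # vs) = - row_det f (us @ y # x # vs)"
proof -
  let ?n = "length us + Suc (Suc (length vs))"
  let ?A = "mat ?n ?n (\<lambda>(i, j). f ((us @ y # x # vs) ! i) j)"
  have "mat ?n ?n (\<lambda>(i, j). f ((us @ x # y # vs) ! i) j) =
      swaprows (length us) (Suc (length us)) ?A"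
    by (rule eq_matI) (auto simp: nth_append nth_Cons')
  also have "det \<dots> = - det ?A"
    by (rule det_swaprows[of _ ?n]) auto
  finally show ?thesis by (simp add: row_det_def)
qed

lemma row_det_move_to_front:
  "row_det f (us @ y # vs) = (-1) ^ length us * row_det f (y # us @ vs)"
proof (induction us arbitrary: vs rule: rev_induct)
  case (snoc u us)
  have "row_det f ((us @ [u]) @ y # vs) = - row_det f (us @ y # u # vs)"
    using row_det_swap_adjacent[of f us u y vs] by simp
  then show ?case using snoc.IH[of "u # vs"] by simp
qed simp

text \<open>
  This is the Laplace expansion along the row \<open>j\<close>: the cofactors of that row do not depend on its
  entries, so those of the original matrix serve for every new row \<open>x\<close>.
\<close>

lemma row_det_replace_row:
  assumes "j < length ys"
  shows "row_det f (ys[j := x]) =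
    (\<Sum>i<length ys. f x i *
       cofactor (mat (length ys) (length ys) (\<lambda>(i, j). f (ys ! i) j)) j i)"
proof -
  let ?n = "length ys"
  let ?A = "mat ?n ?n (\<lambda>(i, j). f (ys ! i) j)"
  let ?B = "mat ?n ?n (\<lambda>(i, l). f (ys[j := x] ! i) l)"
  have "mat_delete ?B j i = mat_delete ?A j i" for i
    unfolding mat_delete_def by (rule eq_matI) auto
  then have "cofactor ?B j i = cofactor ?A j i" for i by (simp add: cofactor_def)
  moreover have "det ?B = (\<Sum>i<?n. ?B $$ (j, i) * cofactor ?B j i)"
    by (rule laplace_expansion_row) (use assms in auto)
  ultimately show ?thesis using assms by (simp add: row_det_def)
qed

text \<open>
  Cramer's rule without division: the linear combination of the rows \<open>ys\<close> with coefficients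
  \<open>row_det f (ys[j := x])\<close> is the row \<open>x\<close> times the determinant.  It follows from
  \<open>adj A \<cdot> A = det A \<cdot> 1\<close> and therefore holds over every commutative ring.
\<close>

lemma row_det_cramer:
  assumes "l < length ys"
  shows "(\<Sum>j<length ys. row_det f (ys[j := x]) * f (ys ! j) l) = row_det f ys * f x l"
proof -
  let ?n = "length ys"
  let ?A = "mat ?n ?n (\<lambda>(i, j). f (ys ! i) j)"
  have A: "?A \<in> carrier_mat ?n ?n" by simp
  have adj: "(\<Sum>j<?n. cofactor ?A j i * f (ys ! j) l) = (if i = l then det ?A else 0)"
    if "i < ?n" for i
  proof -
    have "(adj_mat ?A * ?A) $$ (i, l) = (det ?A \<cdot>\<^sub>m 1\<^sub>m ?n) $$ (i, l)"
      by (simp only: adj_mat(3)[OF A])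
    then show ?thesis using that assms
      by (simp add: adj_mat_def scalar_prod_def atLeast0LessThan)
  qed
  have "(\<Sum>j<?n. row_det f (ys[j := x]) * f (ys ! j) l) =
      (\<Sum>j<?n. \<Sum>i<?n. f x i * (cofactor ?A j i * f (ys ! j) l))"
    by (simp add: row_det_replace_row sum_distrib_right mult.assoc)
  also have "\<dots> = (\<Sum>i<?n. f x i * (\<Sum>j<?n. cofactor ?A j i * f (ys ! j) l))"
    by (subst sum.swap) (simp add: sum_distrib_left)
  also have "\<dots> = (\<Sum>i<?n. if i = l then f x i * det ?A else 0)"
    by (intro sum.cong) (auto simp: adj)
  also have "\<dots> = row_det f ys * f x l"
    using assms by (simp add: row_det_def mult.commute)
  finally show ?thesis .
qed

text \<open>
  The first factor on the left is a linear function of its row \<open>x\<close>.  By Cramer's rule, \<open>x\<close> times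
  the second factor is a combination of the rows \<open>ys\<close>, and the linear function can be applied
  term by term.
\<close>

theorem row_det_pluecker:
  assumes len: "length ys = Suc (length xs)"
  shows "row_det f (x # xs) * row_det f ys =
    (\<Sum>j<length ys. row_det f (ys ! j # xs) * row_det f (ys[j := x]))"
proof -
  let ?n = "Suc (length xs)"
  let ?c = "cofactor (mat ?n ?n (\<lambda>(i, j). f ((x # xs) ! i) j)) 0"
  have expand: "row_det f (y # xs) = (\<Sum>l<?n. f y l * ?c l)" for y
    using row_det_replace_row[of 0 "x # xs" f y] by simp
  have "row_det f (x # xs) * row_det f ys = (\<Sum>l<?n. ?c l * (row_det f ys * f x l))"
    by (simp add: expand sum_distrib_left sum_distrib_right mult_ac del: sum.lessThan_Suc)
  also have "\<dots> = (\<Sum>l<?n. \<Sum>j<?n. ?c l * (row_det f (ys[j := x]) * f (ys ! j) l))"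
    using row_det_cramer[of _ ys f x]
    by (intro sum.cong refl) (simp add: len flip: sum_distrib_left del: sum.lessThan_Suc)
  also have "\<dots> = (\<Sum>j<?n. row_det f (ys ! j # xs) * row_det f (ys[j := x]))"
    by (subst sum.swap)
      (simp add: expand sum_distrib_left sum_distrib_right mult_ac del: sum.lessThan_Suc)
  finally show ?thesis by (simp add: len)
qed

text \<open>
  The Pluecker relation for two families which agree up to the positions in \<open>J\<close> and the last row:
  all other exchanges produce a repeated row.  The rows are put in the order in which the peeled
  partitions list them; moving \<open>x\<close> to the front and \<open>ys ! j\<close> into position \<open>j\<close> costs the same sign
  \<open>(-1)\<^sup>j\<close>, so no signs remain.
\<close>

lemma row_det_exchange:
  assumes len: "length ys = length xs"
    and J: "J \<subseteq> {..<length ys}"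
    and old: "\<And>j. j < length ys \<Longrightarrow> j \<notin> J \<Longrightarrow> ys ! j \<in> set xs"
  shows "row_det f (x # xs) * row_det f (ys @ [e]) =
    row_det f (x # ys) * row_det f (xs @ [e]) +
    (\<Sum>j\<in>J. row_det f (x # take j ys @ drop (Suc j) ys @ [e]) *
       row_det f (take j xs @ [ys ! j] @ drop j xs))"
proof -
  let ?n = "length ys"
  let ?g = "\<lambda>j. row_det f ((ys @ [e]) ! j # xs) * row_det f ((ys @ [e])[j := x])"
  have sign: "(-1) ^ i * ((-1) ^ i * a) = a" for i and a :: 'b
    by (simp flip: mult.assoc power_mult_distrib)
  have "row_det f (x # xs) * row_det f (ys @ [e]) = (\<Sum>j<Suc ?n. ?g j)"
    using row_det_pluecker[of "ys @ [e]" xs f x] len by simp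
  also have "\<dots> = ?g ?n + (\<Sum>j<?n. ?g j)" by (simp add: add.commute)
  also have "?g ?n = row_det f (x # ys) * row_det f (xs @ [e])"
    using row_det_move_to_front[of f xs e "[]"] row_det_move_to_front[of f ys x "[]"] len
    by (simp add: list_update_append nth_append mult_ac sign)
  also have "(\<Sum>j<?n. ?g j) = (\<Sum>j\<in>J. ?g j)"
    by (rule sum.mono_neutral_right) (use J old in \<open>auto simp: nth_append row_det_repeated\<close>)
  also have "\<dots> = (\<Sum>j\<in>J. row_det f (x # take j ys @ drop (Suc j) ys @ [e]) *
       row_det f (take j xs @ [ys ! j] @ drop j xs))"
  proof (rule sum.cong)
    fix j assume "j \<in> J"
    then have j: "j < ?n" using J by auto
    then have "(ys @ [e])[j := x] = take j ys @ x # drop (Suc j) ys @ [e]"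
      by (simp add: list_update_append upd_conv_take_nth_drop)
    then show "?g j = row_det f (x # take j ys @ drop (Suc j) ys @ [e]) *
       row_det f (take j xs @ [ys ! j] @ drop j xs)"
      using row_det_move_to_front[of f "take j ys" x "drop (Suc j) ys @ [e]"]
        row_det_move_to_front[of f "take j xs" "ys ! j" "drop j xs"] j len
      by (simp add: nth_append mult_ac sign)
  qed simp
  finally show ?thesis .
qed

section \<open>Shifted parts and peeling\<close>

text \<open>
  These are the labels of the rows of the Jacobi--Trudi matrix.  Positions are counted from 0 here,
  which shifts all labels by one: the label of a zero in the last of \<open>n\<close> positions is \<open>1 - n\<close>.
\<close>

definition shifted_parts :: "int list \<Rightarrow> int list" where
  "shifted_parts \<nu> = map (\<lambda>i. \<nu> ! i - int i) [0..<length \<nu>]"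

definition complete_row :: "int \<Rightarrow> nat \<Rightarrow> symfun" where
  "complete_row b j = complete_sym (b + int j)"

lemma length_shifted_parts [simp]: "length (shifted_parts \<nu>) = length \<nu>"
  by (simp add: shifted_parts_def)

lemma nth_shifted_parts [simp]:
  "i < length \<nu> \<Longrightarrow> shifted_parts \<nu> ! i = \<nu> ! i - int i"
  by (simp add: shifted_parts_def)

lemma schur_conv_row_det: "schur \<nu> = row_det complete_row (shifted_parts \<nu>)"
  unfolding schur_def row_det_def
  by (intro arg_cong[of _ _ det] eq_matI) (auto simp: complete_row_def)

lemma shifted_parts_Cons:
  "\<nu> \<noteq> [] \<Longrightarrow> shifted_parts \<nu> = \<nu> ! 0 # tl (shifted_parts \<nu>)"
  by (simp add: shifted_parts_def upt_conv_Cons)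

lemma shifted_parts_peel:
  assumes "\<nu> \<noteq> []"
  shows "shifted_parts (peel \<nu>) = tl (shifted_parts \<nu>) @ [1 - int (length \<nu>)]"
  using assms by (intro nth_equalityI) (auto simp: peel_def nth_append nth_tl of_nat_diff Suc_le_eq)

text \<open>
  In the next two lemmas, \<open>Suc i\<close> and \<open>Suc j\<close> are row numbers counted from 1.  A part which moves up
  by one position and loses one box keeps its label.
\<close>

lemma shifted_parts_peel_down:
  assumes "i < length \<nu>"
  shows "shifted_parts (peel_down (Suc i) \<nu>) =
    take i (shifted_parts \<nu>) @ drop (Suc i) (shifted_parts \<nu>) @ [1 - int (length \<nu>)]"
  using assms by (intro nth_equalityI) (auto simp: peel_down_def nth_append of_nat_diff)

lemma shifted_parts_peel_up:
  assumes "Suc j < length \<nu>"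
  shows "shifted_parts (peel_up (Suc j) s \<nu>) =
    take j (tl (shifted_parts \<nu>)) @ [shifted_parts \<nu> ! Suc j + s] @
      drop j (tl (shifted_parts \<nu>))"
proof -
  have "peel_up (Suc j) s \<nu> =
      map (\<lambda>x. x - 1) (take j (tl \<nu>)) @ [\<nu> ! Suc j + s - 1] @ drop (Suc j) \<nu>"
    by (simp add: peel_up_def part_def)
  then show ?thesis
    using assms
    by (intro nth_equalityI) (auto simp: nth_append nth_Cons' nth_tl of_nat_diff min_def)
qed

text \<open>
  The identity for Schur functions needs no more than this about \<open>\<mu>\<close>: it has the first part of
  \<open>\<nu>\<close>, and each of its further labels is a non-first label of \<open>\<nu>\<close> unless its position is in \<open>J\<close>.
\<close>

lemma schur_exchange:
  assumes len: "length \<mu> = length \<nu>" and ne: "\<nu> \<noteq> []"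
    and first: "\<mu> ! 0 = \<nu> ! 0"
    and J: "J \<subseteq> {..<length \<nu> - 1}"
    and new: "\<And>j. j \<in> J \<Longrightarrow> \<mu> ! Suc j = \<nu> ! Suc j + s j"
    and old: "\<And>j. Suc j < length \<nu> \<Longrightarrow> j \<notin> J \<Longrightarrow>
      shifted_parts \<mu> ! Suc j \<in> set (tl (shifted_parts \<nu>))"
  shows "schur \<nu> * schur (peel \<mu>) = schur \<mu> * schur (peel \<nu>) +
    (\<Sum>j\<in>J. schur (peel_down (Suc (Suc j)) \<mu>) * schur (peel_up (Suc j) (s j) \<nu>))"
proof -
  define x where "x = \<nu> ! 0"
  define e where "e = 1 - int (length \<nu>)"
  define xs where "xs = tl (shifted_parts \<nu>)"
  define ys where "ys = tl (shifted_parts \<mu>)"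
  have \<nu>: "shifted_parts \<nu> = x # xs"
    using shifted_parts_Cons[OF ne] by (simp add: x_def xs_def)
  have "\<mu> \<noteq> []" using ne len by auto
  then have \<mu>: "shifted_parts \<mu> = x # ys"
    using shifted_parts_Cons[of \<mu>] first by (simp add: x_def ys_def)
  have lens: "length xs = length \<nu> - 1" "length ys = length xs"
    by (simp_all add: xs_def ys_def len)
  have "row_det complete_row (x # xs) * row_det complete_row (ys @ [e]) =
    row_det complete_row (x # ys) * row_det complete_row (xs @ [e]) +
    (\<Sum>j\<in>J. row_det complete_row (x # take j ys @ drop (Suc j) ys @ [e]) *
       row_det complete_row (take j xs @ [ys ! j] @ drop j xs))"
  proof (rule row_det_exchange)
    show "ys ! j \<in> set xs" if "j < length ys" "j \<notin> J" for j
      using old[of j] that lens by (simp add: xs_def \<mu>)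
  qed (use J lens in auto)
  moreover have "row_det complete_row (x # take j ys @ drop (Suc j) ys @ [e]) =
      schur (peel_down (Suc (Suc j)) \<mu>)" if "j \<in> J" for j
    using that J lens len by (auto simp: schur_conv_row_det shifted_parts_peel_down \<mu> e_def)
  moreover have "row_det complete_row (take j xs @ [ys ! j] @ drop j xs) =
      schur (peel_up (Suc j) (s j) \<nu>)" if "j \<in> J" for j
  proof -
    have j: "Suc j < length \<nu>" using that J by auto
    have "ys ! j = shifted_parts \<mu> ! Suc j" by (simp add: \<mu>)
    also have "\<dots> = shifted_parts \<nu> ! Suc j + s j" using j len new[OF that] by simp
    finally show ?thesis using j by (simp add: schur_conv_row_det shifted_parts_peel_up xs_def)
  qed
  ultimately show ?thesis
    using ne \<open>\<mu> \<noteq> []\<close> len by (simp add: schur_conv_row_det shifted_parts_peel \<nu> \<mu> e_def)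
qed

section \<open>Adding border strips\<close>

text \<open>
  The sentinel \<open>r (k + 1) = n + 1\<close> bounds the last strip in the same way as the end row of a next
  strip would.
\<close>

locale border_strips =
  fixes lam :: "int list" and n k :: nat
    and r m :: "nat \<Rightarrow> nat" and t :: "nat \<Rightarrow> int"
  assumes partition: "is_partition lam" and length_lam: "length lam = n"
    and strips: "1 \<le> k"
    and first_row: "2 \<le> r 1" and r_less: "\<And>i. i \<in> {1..k} \<Longrightarrow> r i < r (i + 1)"
    and r_end: "r (k + 1) = n + 1"
    and t: "\<And>i. i \<in> {1..k} \<Longrightarrow> 1 \<le> t i \<and> t i \<le> part lam (r i - 1) - part lam (r i)"
    and m: "\<And>i. i \<in> {1..k} \<Longrightarrow> 1 \<le> m i \<and> m i \<le> r (i + 1) - r i"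
begin

lemma next_end_row_le:
  assumes "1 \<le> i" "i < j" "j \<le> k + 1"
  shows "r (i + 1) \<le> r j"
proof -
  have "Suc i \<le> j" using assms by simp
  then show ?thesis using assms(3)
  proof (induction j rule: dec_induct)
    case (step j)
    then show ?case using r_less[of j] assms(1) by simp
  qed simp
qed

lemma strips_disjoint:
  assumes "1 \<le> i" "i < j" "j \<le> k + 1"
  shows "r i + m i \<le> r j"
  using m[of i] r_less[of i] next_end_row_le[OF assms] assms by fastforce

lemma row_bounds:
  assumes "i \<in> {1..k}"
  shows "2 \<le> r i" "r i + m i \<le> n + 1" "r i \<le> n"
proof -
  show "2 \<le> r i"
    using assms first_row strips_disjoint[of 1 i] by (cases "i = 1") auto
  show "r i + m i \<le> n + 1" using strips_disjoint[of i "k + 1"] assms r_end by simp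
  then show "r i \<le> n" using m[OF assms] by simp
qed

lemma same_strip:
  assumes "i \<in> {1..k}" "j \<in> {1..k}" and "q \<in> {r i..<r i + m i}" "q \<in> {r j..<r j + m j}"
  shows "i = j"
  using strips_disjoint[of i j] strips_disjoint[of j i] assms by (cases i j rule: linorder_cases) auto

lemma inj_on_r: "inj_on r {1..k}"
proof (rule inj_onI)
  fix i j assume "i \<in> {1..k}" "j \<in> {1..k}" "r i = r j"
  then show "i = j" using same_strip[of i j "r i"] m[of i] m[of j] by simp
qed

text \<open>
  The parts of the partition \<open>\<lambda>\<^sup>+\<close>.  The end row \<open>q\<close> of a strip determines the number of the strip,
  hence the boxes \<open>t\<close> to be added, because \<open>r\<close> is injective.
\<close>

definition new_part :: "nat \<Rightarrow> int" where
  "new_part q =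
    (if q \<in> r ` {1..k} then part lam q + t (the_inv_into {1..k} r q)
     else if \<exists>i\<in>{1..k}. q \<in> {r i..<r i + m i} then part lam (q - 1) + 1
     else part lam q)"

lemma new_part_end_row:
  "i \<in> {1..k} \<Longrightarrow> new_part (r i) = part lam (r i) + t i"
  using the_inv_into_f_f[OF inj_on_r, of i] by (auto simp: new_part_def)

text \<open>
  Disjointness of the strips is what makes the clauses for different strips compatible: an inner
  row of a strip is never the end row of another one.
\<close>

lemma new_part_inner_row:
  assumes i: "i \<in> {1..k}" and q: "r i < q" "q < r i + m i"
  shows "new_part q = part lam (q - 1) + 1"
proof -
  have "q \<noteq> r j" if "j \<in> {1..k}" for j
    using same_strip[of i j q] that i q m[of j] by auto
  then have "q \<notin> r ` {1..k}" by blast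
  moreover have "\<exists>i\<in>{1..k}. q \<in> {r i..<r i + m i}" using i q by (intro bexI[of _ i]) auto
  ultimately show ?thesis unfolding new_part_def by (simp only: if_True if_False)
qed

lemma new_part_other_row:
  assumes "\<And>i. i \<in> {1..k} \<Longrightarrow> q \<notin> {r i..<r i + m i}"
  shows "new_part q = part lam q"
proof -
  have "q \<noteq> r i" if "i \<in> {1..k}" for i using assms[OF that] m[OF that] by auto
  then have "q \<notin> r ` {1..k}" by blast
  moreover have "\<not> (\<exists>i\<in>{1..k}. q \<in> {r i..<r i + m i})" using assms by blast
  ultimately show ?thesis unfolding new_part_def by (simp only: if_False)
qed

lemma row_cases:
  obtains (end_row) i where "i \<in> {1..k}" "q = r i"
  | (inner_row) i where "i \<in> {1..k}" "r i < q" "q < r i + m i"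
  | (other_row) "\<And>i. i \<in> {1..k} \<Longrightarrow> q \<notin> {r i..<r i + m i}"
  by (metis atLeastLessThan_iff le_neq_implies_less)

lemma border_strips_added_iff:
  "border_strips_added lam k r t m \<mu> \<longleftrightarrow>
    length \<mu> = n \<and> (\<forall>q\<in>{1..n}. part \<mu> q = new_part q)"
proof (intro iffI conjI ballI)
  assume added: "border_strips_added lam k r t m \<mu>"
  then show "length \<mu> = n" by (simp add: border_strips_added_def length_lam)
  fix q assume q: "q \<in> {1..n}"
  show "part \<mu> q = new_part q"
  proof (cases q rule: row_cases)
    case (end_row i)
    then show ?thesis
      using added by (simp add: border_strips_added_def new_part_end_row)
  next
    case (inner_row i)
    then have "q - r i \<in> {1..m i - 1}" by auto
    then have "part \<mu> (r i + (q - r i)) = part lam (r i + (q - r i) - 1) + 1"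
      using added inner_row(1) unfolding border_strips_added_def by blast
    then show ?thesis using inner_row by (simp add: new_part_inner_row)
  next
    case other_row
    then show ?thesis
      using added q new_part_other_row[OF other_row] unfolding border_strips_added_def length_lam
      by metis
  qed
next
  assume new: "length \<mu> = n \<and> (\<forall>q\<in>{1..n}. part \<mu> q = new_part q)"
  show "border_strips_added lam k r t m \<mu>"
    unfolding border_strips_added_def
  proof (intro conjI ballI impI)
    show "length \<mu> = length lam" using new by (simp add: length_lam)
  next
    fix i assume i: "i \<in> {1..k}"
    then show "part \<mu> (r i) = part lam (r i) + t i"
      using new row_bounds[OF i] by (simp add: new_part_end_row)
  next
    fix i j assume i: "i \<in> {1..k}" and j: "j \<in> {1..m i - 1}"
    then show "part \<mu> (r i + j) = part lam (r i + j - 1) + 1"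
      using new row_bounds[OF i] new_part_inner_row[OF i, of "r i + j"] by auto
  next
    fix q assume "q \<in> {1..length lam}" "\<forall>i\<in>{1..k}. q \<notin> {r i..<r i + m i}"
    then show "part \<mu> q = part lam q"
      using new new_part_other_row[of q] length_lam by metis
  qed
qed

lemma border_strips_added_ex1: "\<exists>!\<mu>. border_strips_added lam k r t m \<mu>"
proof (rule ex1I)
  show "border_strips_added lam k r t m (map new_part [1..<n + 1])"
    by (auto simp: border_strips_added_iff part_def simp del: upt_Suc)
next
  fix \<mu> assume "border_strips_added lam k r t m \<mu>"
  then have len: "length \<mu> = n" and new: "\<And>q. q \<in> {1..n} \<Longrightarrow> part \<mu> q = new_part q"
    by (auto simp: border_strips_added_iff)
  show "\<mu> = map new_part [1..<n + 1]"
  proof (rule nth_equalityI)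
    fix i assume "i < length \<mu>"
    then show "\<mu> ! i = map new_part [1..<n + 1] ! i"
      using new[of "Suc i"] len by (simp add: part_def del: upt_Suc)
  qed (simp add: len)
qed

lemma part_decreasing:
  assumes "1 \<le> q" "q < n"
  shows "part lam (q + 1) \<le> part lam q"
  using partition assms sorted_wrt_nth_less[of "(\<ge>)" lam "q - 1" q]
  by (simp add: is_partition_def part_def length_lam)

lemma part_le_new_part:
  assumes "q \<in> {1..n}"
  shows "part lam q \<le> new_part q"
proof (cases q rule: row_cases)
  case (end_row i)
  then show ?thesis using t[of i] by (simp add: new_part_end_row)
next
  case (inner_row i)
  then show ?thesis
    using part_decreasing[of "q - 1"] row_bounds(1)[OF inner_row(1)] assms
      new_part_inner_row[of i q] by fastforce
next
  case other_row
  then show ?thesis using new_part_other_row[of q] by simp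
qed

text \<open>
  An end row grows to \<open>\<lambda>\<^bsub>r-1\<^esub>\<close> at most, by the choice of \<open>t\<close>.  An inner row receives
  \<open>\<lambda>\<^sub>q + 1\<close> from the row \<open>q\<close> above it, and that row has itself received at least one box, since it
  belongs to the same strip.
\<close>

lemma new_part_decreasing:
  assumes "1 \<le> q" "q < n"
  shows "new_part (q + 1) \<le> new_part q"
proof -
  have le: "part lam q \<le> new_part q" using part_le_new_part assms by simp
  show ?thesis
  proof (cases "q + 1" rule: row_cases)
    case (end_row i)
    have "r i - 1 = q" using end_row(2) by simp
    then have "new_part (q + 1) \<le> part lam q"
      using t[OF end_row(1)] new_part_end_row[OF end_row(1)] end_row(2) by simp
    then show ?thesis using le by simp
  next
    case (inner_row i)
    have "part lam q + 1 \<le> new_part q"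
    proof (cases "q = r i")
      case True
      then show ?thesis using t inner_row(1) by (simp add: new_part_end_row)
    next
      case False
      then show ?thesis
        using inner_row part_decreasing[of "q - 1"] row_bounds[of i] assms
        by (simp add: new_part_inner_row)
    qed
    then show ?thesis using inner_row by (simp add: new_part_inner_row)
  next
    case other_row
    then show ?thesis using part_decreasing[OF assms] le new_part_other_row[of "q + 1"] by simp
  qed
qed

lemma is_partition_added:
  assumes "border_strips_added lam k r t m \<mu>"
  shows "is_partition \<mu>"
proof -
  have len: "length \<mu> = n" and new: "\<And>i. i < n \<Longrightarrow> \<mu> ! i = new_part (i + 1)"
    using border_strips_added_iff[of \<mu>] assms by (force simp: part_def)+
  have "sorted_wrt (\<ge>) \<mu>"
    using new new_part_decreasing len
    by (auto simp: sorted_wrt_iff_nth_Suc_transp)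
  moreover have "0 \<le> \<mu> ! i" if "i < n" for i
  proof -
    have "0 \<le> part lam (i + 1)"
      using partition that by (simp add: is_partition_def part_def length_lam)
    then show ?thesis using part_le_new_part[of "i + 1"] new[OF that] that by simp
  qed
  ultimately show ?thesis by (auto simp: is_partition_def in_set_conv_nth len)
qed

text \<open>
  Outside the end rows no new label arises: an inner row takes over the label of the row above
  it.  That label is not the first one because every strip starts in row 2 or below.
\<close>

lemma shifted_part_added_old:
  assumes added: "border_strips_added lam k r t m \<mu>"
    and j: "Suc j < n" and no_end: "\<And>i. i \<in> {1..k} \<Longrightarrow> Suc (Suc j) \<noteq> r i"
  shows "shifted_parts \<mu> ! Suc j \<in> set (tl (shifted_parts lam))"
proof -
  have len: "length \<mu> = n" and new: "\<mu> ! Suc j = new_part (Suc (Suc j))"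
    using added j by (auto simp: border_strips_added_iff part_def dest: bspec[of _ _ "Suc (Suc j)"])
  have old: "lam ! Suc l - int (Suc l) \<in> set (tl (shifted_parts lam))" if "Suc l < n" for l
    using that length_lam nth_mem[of l "tl (shifted_parts lam)"] by (simp add: nth_tl)
  show ?thesis
  proof (cases "Suc (Suc j)" rule: row_cases)
    case (end_row i)
    then show ?thesis using no_end by auto
  next
    case (inner_row i)
    then have "\<mu> ! Suc j = lam ! j + 1"
      using new by (simp add: new_part_inner_row part_def)
    moreover have "1 \<le> j" using inner_row row_bounds[of i] by simp
    ultimately show ?thesis using old[of "j - 1"] j len by (simp add: of_nat_diff)
  next
    case other_row
    then have "\<mu> ! Suc j = lam ! Suc j" using new new_part_other_row[of "Suc (Suc j)"] by (simp add: part_def)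
    then show ?thesis using old[of j] j len by simp
  qed
qed

lemma schur_identity:
  assumes added: "border_strips_added lam k r t m \<mu>"
  shows "schur lam * schur (peel \<mu>) = schur \<mu> * schur (peel lam) +
    (\<Sum>p=1..k. schur (peel_down (r p) \<mu>) * schur (peel_up (r p - 1) (t p) lam))"
proof -
  have len: "length \<mu> = n" and new: "\<And>i. i < n \<Longrightarrow> \<mu> ! i = new_part (i + 1)"
    using border_strips_added_iff[of \<mu>] added by (force simp: part_def)+
  \<comment> \<open>The position of the row \<open>r p\<close>, counted from 0, after the first row has been removed.\<close>
  let ?row = "\<lambda>p. r p - 2"
  have row: "r p = Suc (Suc (?row p))" "Suc (?row p) < n" if "p \<in> {1..k}" for p
    using row_bounds[OF that] by auto
  have inj: "inj_on ?row {1..k}"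
    using inj_on_r row(1) unfolding inj_on_def by metis
  let ?s = "\<lambda>j. t (the_inv_into {1..k} ?row j)"
  have s: "?s (?row p) = t p" if "p \<in> {1..k}" for p
    using the_inv_into_f_f[OF inj that] by simp
  have "schur lam * schur (peel \<mu>) = schur \<mu> * schur (peel lam) +
    (\<Sum>j\<in>?row ` {1..k}. schur (peel_down (Suc (Suc j)) \<mu>) * schur (peel_up (Suc j) (?s j) lam))"
  proof (rule schur_exchange)
    have "0 < n" using row(2)[of 1] strips by simp
    then show "lam \<noteq> []" using length_lam by auto
    have "1 \<notin> {r i..<r i + m i}" if "i \<in> {1..k}" for i using row_bounds[OF that] by simp
    then show "\<mu> ! 0 = lam ! 0"
      using new[OF \<open>0 < n\<close>] new_part_other_row[of 1] by (simp add: part_def)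
    show "?row ` {1..k} \<subseteq> {..<length lam - 1}" using row(2) length_lam by fastforce
    show "\<mu> ! Suc j = lam ! Suc j + ?s j" if j: "j \<in> ?row ` {1..k}" for j
    proof -
      obtain p where p: "p \<in> {1..k}" "j = ?row p" using j by blast
      then have "\<mu> ! Suc j = new_part (r p)" using new row[OF p(1)] by simp
      also have "\<dots> = part lam (r p) + t p" by (rule new_part_end_row[OF p(1)])
      also have "part lam (r p) = lam ! Suc j"
      proof -
        have "r p - 1 = Suc j" using row(1)[OF p(1)] p(2) by linarith
        then show ?thesis by (simp add: part_def)
      qed
      finally show ?thesis using s[OF p(1)] p(2) by simp
    qed
    show "shifted_parts \<mu> ! Suc j \<in> set (tl (shifted_parts lam))"
      if "Suc j < length lam" "j \<notin> ?row ` {1..k}" for j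
      using shifted_part_added_old[OF added, of j] that length_lam by force
  qed (simp add: len length_lam)
  also have "(\<Sum>j\<in>?row ` {1..k}. schur (peel_down (Suc (Suc j)) \<mu>) *
        schur (peel_up (Suc j) (?s j) lam)) =
      (\<Sum>p=1..k. schur (peel_down (r p) \<mu>) * schur (peel_up (r p - 1) (t p) lam))"
  proof (subst sum.reindex[OF inj], rule sum.cong)
    fix p assume p: "p \<in> {1..k}"
    have "Suc (?row p) = r p - 1" "Suc (Suc (?row p)) = r p" using row(1)[OF p] by simp_all
    then show "((\<lambda>j. schur (peel_down (Suc (Suc j)) \<mu>) * schur (peel_up (Suc j) (?s j) lam)) \<circ> ?row) p =
        schur (peel_down (r p) \<mu>) * schur (peel_up (r p - 1) (t p) lam)"
      using s[OF p] by simp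
  qed simp
  finally show ?thesis .
qed

end

theorem proposition1:
  fixes lam :: "int list" and n k :: nat
    and r m :: "nat \<Rightarrow> nat" and t :: "nat \<Rightarrow> int"
  assumes "is_partition lam" and "length lam = n" and "height lam = n"
    and "1 \<le> k"
    and "2 \<le> r 1" and "\<forall>i\<in>{1..k}. r i < r (i + 1)" and "r (k + 1) = n + 1"
    and "\<forall>i\<in>{1..k}. part lam (r i) < part lam (r i - 1)"
    and "\<forall>i\<in>{1..k}. 1 \<le> t i \<and> t i \<le> part lam (r i - 1) - part lam (r i)"
    and "\<forall>i\<in>{1..k}. 1 \<le> m i \<and> m i \<le> r (i + 1) - r i"
  shows "(\<exists>!lam_plus. border_strips_added lam k r t m lam_plus) \<and>
    (\<forall>lam_plus. border_strips_added lam k r t m lam_plus \<longrightarrow>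
       is_partition lam_plus \<and>
       schur lam * schur (peel lam_plus) =
         schur lam_plus * schur (peel lam) +
         (\<Sum>p=1..k. schur (peel_down (r p) lam_plus) * schur (peel_up (r p - 1) (t p) lam)))"
proof -
  interpret border_strips lam n k r m t
    using assms by unfold_locales auto
  show ?thesis
    using border_strips_added_ex1 is_partition_added schur_identity by blast
qed

end
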